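(* Let $n\ge 1$. A function $f:[0,1]^n\to[0,1]$ is monotone if and only if there exist a collection of nested up-sets $\{A_r\}_{r\in[0,1]}$ of $[0,1]^n$ and a Borel probability measure $\mu$ on $[0,1]$ such that for all $x\in[0,1]^n$, $$f(x)=\int_0^1 \mathbf 1_{A_r}(x)\,\mu(dr).$$ Moreover, if $\{A_r\}_{r\in[0,1]}$ and $\{A'_r\}_{r\in[0,1]}$ are collections of nested up-sets of $[0,1]^n$ and $\mu,\mu'$ are Borel probability measures on $[0,1]$ such that $(\{A_r\}_{r\in[0,1]},\mu)$ and $(\{A'_r\}_{r\in[0,1]},\mu')$ both represent the same monotone function $f:[0,1]^n\to[0,1]$, in the sense that $f(x)=\int_0^1 \mathbf 1_{A_r}(x)\,\mu(dr)=\int_0^1 \mathbf 1_{A'_r}(x)\,\mu'(dr)$ for all $x\in[0,1]^n$, then they induce the same distribution over up-sets (up-sets being identified when they differ by a Lebesgue-null set): the pushforward of $\mu$ under $r\mapsto \mathbf 1_{A_r}\in L^1([0,1]^n)$ equals the pushforward of $\mu'$ under $r\mapsto \mathbf 1_{A'_r}\in L^1([0,1]^n)$.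
   Context: The order $\le$ on $[0,1]^n$ is the component-wise order. A function $f:[0,1]^n\to[0,1]$ is monotone if $f(x)\le f(y)$ whenever $x\le y$. A set $A\subseteq[0,1]^n$ is an up-set if $x\in A$ and $y\ge x$, $y\in[0,1]^n$, imply $y\in A$. A family $\{A_r\}_{r\in[0,1]}$ is nested if $A_r\subseteq A_{r'}$ whenever $r<r'$. *)

theory Defs
  imports "HOL-Probability.Probability"
begin

text \<open>
  The cube \<open>[0,1]\<^sup>n\<close> is \<open>{0..1} :: (real^'n) set\<close>, where \<open>n = CARD('n)\<close> and the order on
  \<open>real^'n\<close> is the component-wise one.
\<close>

definition up_set :: "(real^'n) set \<Rightarrow> bool" where
  "up_set A \<longleftrightarrow> A \<subseteq> {0..1} \<and> (\<forall>x\<in>A. \<forall>y\<in>{0..1}. x \<le> y \<longrightarrow> y \<in> A)"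

definition nested_up_sets :: "(real \<Rightarrow> (real^'n) set) \<Rightarrow> bool" where
  "nested_up_sets A \<longleftrightarrow> (\<forall>r\<in>{0..1}. up_set (A r)) \<and>
     (\<forall>r\<in>{0..1}. \<forall>r'\<in>{0..1}. r < r' \<longrightarrow> A r \<subseteq> A r')"

text \<open>The underlying set of such a measure is \<open>{0..1}\<close>, since \<open>space\<close> is determined by \<open>sets\<close>.\<close>

definition borel_prob_on_unit :: "real measure \<Rightarrow> bool" where
  "borel_prob_on_unit \<mu> \<longleftrightarrow> prob_space \<mu> \<and> sets \<mu> = sets (restrict_space borel {0..1})"

definition represents :: "(real \<Rightarrow> (real^'n) set) \<Rightarrow> real measure \<Rightarrow> (real^'n \<Rightarrow> real) \<Rightarrow> bool" where
  "represents A \<mu> f \<longleftrightarrow> (\<forall>x\<in>{0..1}. f x = (\<integral>r. indicat_real (A r) x \<partial>\<mu>))"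

text \<open>
  The space \<open>L\<^sup>1([0,1]\<^sup>n)\<close> of classes of Lebesgue integrable functions on the cube.
  Lebesgue rather than Borel measurability is needed, because up-sets need not be Borel.
\<close>

abbreviation cube_measure :: "(real^'n) measure" where
  "cube_measure \<equiv> lebesgue_on {0..1}"

definition L1_eq :: "(real^'n \<Rightarrow> real) \<Rightarrow> (real^'n \<Rightarrow> real) \<Rightarrow> bool" where
  "L1_eq g h \<longleftrightarrow> integrable cube_measure g \<and> integrable cube_measure h \<and>
     (AE x in cube_measure. g x = h x)"

lemma part_equivp_L1_eq: "part_equivp L1_eq"
proof (rule part_equivpI)
  show "\<exists>g. L1_eq g g"
    by (rule exI[of _ "\<lambda>_. 0"]) (simp add: L1_eq_def)
  show "symp L1_eq"
    by (auto simp: symp_def L1_eq_def eq_commute)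
  show "transp L1_eq"
    unfolding transp_def L1_eq_def by fastforce
qed

quotient_type 'n L1_cube = "real^'n \<Rightarrow> real" / partial: "L1_eq"
  morphisms L1_rep L1_class
  by (rule part_equivp_L1_eq)

instantiation L1_cube :: (finite) metric_space
begin

lift_definition dist_L1_cube :: "'a L1_cube \<Rightarrow> 'a L1_cube \<Rightarrow> real"
  is "\<lambda>g h. \<integral>x. \<bar>g x - h x\<bar> \<partial>cube_measure"
proof -
  fix g g' h h' :: "real^'a \<Rightarrow> real"
  assume "L1_eq g g'" "L1_eq h h'"
  then show "(\<integral>x. \<bar>g x - h x\<bar> \<partial>cube_measure) = (\<integral>x. \<bar>g' x - h' x\<bar> \<partial>cube_measure)"
    unfolding L1_eq_def by (intro integral_cong_AE) auto
qed

definition uniformity_L1_cube :: "('a L1_cube \<times> 'a L1_cube) filter" where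
  "uniformity_L1_cube = (INF e\<in>{0<..}. principal {(u, v). dist u v < e})"

definition open_L1_cube :: "'a L1_cube set \<Rightarrow> bool" where
  "open_L1_cube U \<longleftrightarrow> (\<forall>u\<in>U. \<forall>\<^sub>F (u', v) in uniformity. u' = u \<longrightarrow> v \<in> U)"

instance
proof
  show "uniformity = (INF e\<in>{0<..}. principal {(u, v::'a L1_cube). dist u v < e})"
    by (rule uniformity_L1_cube_def)
  show "open U \<longleftrightarrow> (\<forall>u\<in>U. \<forall>\<^sub>F (u', v) in uniformity. u' = u \<longrightarrow> v \<in> U)"
    for U :: "'a L1_cube set"
    by (rule open_L1_cube_def)
  show "dist u v = 0 \<longleftrightarrow> u = v" for u v :: "'a L1_cube"
  proof transfer
    fix g h :: "real^'a \<Rightarrow> real"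
    assume gh: "L1_eq g g" "L1_eq h h"
    then have "(\<integral>x. \<bar>g x - h x\<bar> \<partial>cube_measure) = 0 \<longleftrightarrow> (AE x in cube_measure. \<bar>g x - h x\<bar> = 0)"
      unfolding L1_eq_def by (intro integral_nonneg_eq_0_iff_AE) auto
    with gh show "(\<integral>x. \<bar>g x - h x\<bar> \<partial>cube_measure) = 0 \<longleftrightarrow> L1_eq g h"
      by (simp add: L1_eq_def)
  qed
  show "dist u v \<le> dist u w + dist v w" for u v w :: "'a L1_cube"
  proof transfer
    fix g h k :: "real^'a \<Rightarrow> real"
    assume "L1_eq g g" "L1_eq h h" "L1_eq k k"
    then have int: "integrable cube_measure g" "integrable cube_measure h" "integrable cube_measure k"
      by (simp_all add: L1_eq_def)
    then have "(\<integral>x. \<bar>g x - h x\<bar> \<partial>cube_measure)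
        \<le> (\<integral>x. \<bar>g x - k x\<bar> + \<bar>h x - k x\<bar> \<partial>cube_measure)"
      by (intro integral_mono) auto
    also have "\<dots> = (\<integral>x. \<bar>g x - k x\<bar> \<partial>cube_measure) + (\<integral>x. \<bar>h x - k x\<bar> \<partial>cube_measure)"
      using int by (intro Bochner_Integration.integral_add) auto
    finally show "(\<integral>x. \<bar>g x - h x\<bar> \<partial>cube_measure)
        \<le> (\<integral>x. \<bar>g x - k x\<bar> \<partial>cube_measure) + (\<integral>x. \<bar>h x - k x\<bar> \<partial>cube_measure)" .
  qed
qed

end

definition up_set_law :: "(real \<Rightarrow> (real^'n) set) \<Rightarrow> real measure \<Rightarrow> 'n L1_cube measure" where
  "up_set_law A \<mu> = distr \<mu> borel (\<lambda>r. L1_class (indicat_real (A r)))"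

text \<open>
  The totalised operations above are used only where they are meaningful:
  indicators of up-sets are integrable, so \<open>L1_class\<close> is applied to genuine elements,
  and for nested up-sets the integrand in \<open>represents\<close> and the map in \<open>up_set_law\<close> are measurable.
\<close>

lemma up_set_sets_lebesgue:
  fixes A :: "(real^'n) set"
  assumes "up_set A"
  shows "A \<in> sets lebesgue"
proof -
  define B where "B = {y. \<exists>a\<in>A. a \<le> y}"
  have sub: "A \<subseteq> {0..1}"
    using assms by (simp add: up_set_def)
  have A_eq: "A = B \<inter> {0..1}"
    using assms by (auto simp: B_def up_set_def)
  have open_greater: "open {z. \<forall>i. x$i < z$i}" and open_less: "open {z. \<forall>i. z$i < x$i}"
    for x :: "real^'n"
    by (simp_all add: Collect_all_eq open_INT open_Collect_less continuous_on_component)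
  have interior: "y \<in> interior B" if x: "x \<in> closure B" and xy: "\<And>i. x$i < y$i" for x y
  proof -
    let ?U = "{z. \<forall>i. x$i < z$i}"
    have "open ?U"
      by (rule open_greater)
    moreover have "?U \<subseteq> B"
    proof
      fix z assume z: "z \<in> ?U"
      have "open {w. \<forall>i. w$i < z$i}"
        by (rule open_less)
      from open_Int_closure_eq_empty[OF this, of B] x z
      obtain w where "w \<in> B" "\<forall>i. w$i < z$i"
        by blast
      then obtain a where "a \<in> A" "a \<le> w" "w \<le> z"
        by (auto simp: B_def less_eq_vec_def less_imp_le)
      then show "z \<in> B"
        unfolding B_def using order_trans by blast
    qed
    ultimately show ?thesis
      using xy by (auto simp: interior_def)
  qed
  have "B \<subseteq> {0..}"
    using sub by (force simp: B_def)
  then have "closure B \<subseteq> {0..}"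
    by (intro closure_minimal closed_eucl_atLeast)
  then have nonneg: "0 \<le> x$i" if "x \<in> frontier B" for x i
    using that by (auto simp: frontier_def less_eq_vec_def)
  have "negligible (frontier B)"
  proof (rule starlike_negligible[of _ "-1"])
    fix c :: real and x :: "real^'n"
    assume cx: "-1 + c *\<^sub>R x \<in> frontier B" and c: "0 \<le> c" and x: "-1 + x \<in> frontier B"
    have pos: "0 < x$i" for i
      using nonneg[OF x, of i] by simp
    show "c = 1"
    proof (rule ccontr)
      assume "c \<noteq> 1"
      then consider "c < 1" | "1 < c"
        by linarith
      then show False
      proof cases
        case 1
        then have "-1 + x \<in> interior B"
          using cx pos by (intro interior[of "-1 + c *\<^sub>R x"]) (auto simp: frontier_def)
        then show False
          using x by (simp add: frontier_def)
      next
        case 2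
        then have "-1 + c *\<^sub>R x \<in> interior B"
          using x pos by (intro interior[of "-1 + x"]) (auto simp: frontier_def)
        then show False
          using cx by (simp add: frontier_def)
      qed
    qed
  qed simp
  then have "negligible (B \<inter> frontier B)"
    by (rule negligible_subset) auto
  moreover have "B = interior B \<union> (B \<inter> frontier B)"
    using interior_subset[of B] closure_subset[of B] by (auto simp: frontier_def)
  ultimately have "B \<in> sets lebesgue"
    using negligible_imp_sets[of "B \<inter> frontier B"] sets.Un[of "interior B" lebesgue "B \<inter> frontier B"]
    by simp
  then show ?thesis
    unfolding A_eq by auto
qed

lemma integrable_indicator_up_set:
  fixes A :: "(real^'n) set"
  assumes "up_set A"
  shows "integrable cube_measure (indicat_real A)"
proof (rule integrable_real_indicator)
  have "A \<subseteq> {0..1}"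
    using assms by (simp add: up_set_def)
  then show "A \<in> sets cube_measure"
    using up_set_sets_lebesgue[OF assms] by (simp add: sets_restrict_space_iff)
  have "emeasure cube_measure A = emeasure lebesgue A"
    using \<open>A \<subseteq> {0..1}\<close> by (simp add: emeasure_restrict_space)
  also have "\<dots> \<le> emeasure lebesgue {0..1::real^'n}"
    using \<open>A \<subseteq> {0..1}\<close> by (intro emeasure_mono) auto
  also have "\<dots> < \<infinity>"
    using lmeasurable_cbox[of 0 "1::real^'n"] by (simp add: fmeasurable_def cbox_interval)
  finally show "emeasure cube_measure A < \<infinity>" .
qed

lemma borel_measurable_nested_indicator:
  fixes A :: "real \<Rightarrow> (real^'n) set"
  assumes "nested_up_sets A" "borel_prob_on_unit \<mu>"
  shows "(\<lambda>r. indicat_real (A r) x) \<in> borel_measurable \<mu>"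
proof -
  have "mono_on {0..1} (\<lambda>r. indicat_real (A r) x)"
  proof (rule mono_onI)
    fix r s :: real assume "r \<in> {0..1}" "s \<in> {0..1}" "r \<le> s"
    then have "A r \<subseteq> A s"
      using assms(1) by (cases "r = s") (auto simp: nested_up_sets_def)
    then show "indicat_real (A r) x \<le> indicat_real (A s) x"
      by (auto simp: indicator_def)
  qed
  then have "(\<lambda>r. indicat_real (A r) x) \<in> borel_measurable (restrict_space borel {0..1})"
    by (rule borel_measurable_mono_on_fnc)
  then show ?thesis
    using assms(2) by (simp add: borel_prob_on_unit_def cong: measurable_cong_sets)
qed

lemma borel_measurable_nested_L1_class:
  fixes A :: "real \<Rightarrow> (real^'n) set"
  assumes A: "nested_up_sets A" and \<mu>: "borel_prob_on_unit \<mu>"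
  shows "(\<lambda>r. L1_class (indicat_real (A r))) \<in> borel_measurable \<mu>"
proof -
  let ?\<phi> = "\<lambda>r. L1_class (indicat_real (A r))"
  define m where "m r = (\<integral>x. indicat_real (A r) x \<partial>cube_measure)" for r
  have int: "integrable cube_measure (indicat_real (A r))" if "r \<in> {0..1}" for r
    using A that by (intro integrable_indicator_up_set) (simp add: nested_up_sets_def)
  have sub: "A r \<subseteq> A s" if "r \<in> {0..1}" "s \<in> {0..1}" "r \<le> s" for r s
    using A that by (cases "r = s") (auto simp: nested_up_sets_def)
  have dist1: "dist (?\<phi> r) (?\<phi> s) = m s - m r" and mono: "m r \<le> m s"
    if rs: "r \<in> {0..1}" "s \<in> {0..1}" "r \<le> s" for r s
  proof -
    have "dist (?\<phi> r) (?\<phi> s) = (\<integral>x. \<bar>indicat_real (A r) x - indicat_real (A s) x\<bar> \<partial>cube_measure)"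
      using int rs by (subst dist_L1_cube.abs_eq) (auto simp: L1_eq_def)
    also have "\<dots> = (\<integral>x. indicat_real (A s) x - indicat_real (A r) x \<partial>cube_measure)"
      using sub[OF rs] by (intro Bochner_Integration.integral_cong) (auto simp: indicator_def)
    also have "\<dots> = m s - m r"
      using int rs by (simp add: m_def)
    finally show d: "dist (?\<phi> r) (?\<phi> s) = m s - m r" .
    show "m r \<le> m s"
      using d zero_le_dist[of "?\<phi> r" "?\<phi> s"] by linarith
  qed
  have dist: "dist (?\<phi> r) (?\<phi> s) = dist (m r) (m s)" if "r \<in> {0..1}" "s \<in> {0..1}" for r s
    using dist1[of r s] dist1[of s r] mono[of r s] mono[of s r] that
    by (cases "r \<le> s") (auto simp: dist_commute dist_real_def)
  have "m \<in> borel_measurable (restrict_space borel {0..1})"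
    using mono by (intro borel_measurable_mono_on_fnc mono_onI)
  then have m: "m \<in> borel_measurable \<mu>"
    using \<mu> by (simp add: borel_prob_on_unit_def cong: measurable_cong_sets)
  have space: "space \<mu> = {0..1}"
    using \<mu> sets_eq_imp_space_eq[of \<mu> "restrict_space borel {0..1}"]
    by (simp add: borel_prob_on_unit_def space_restrict_space)
  show ?thesis
  proof (rule borel_measurableI)
    fix S :: "'n L1_cube set"
    assume S: "open S"
    let ?R = "{r\<in>{0..1}. ?\<phi> r \<in> S}"
    have "\<forall>r\<in>?R. \<exists>e>0. ball (?\<phi> r) e \<subseteq> S"
      using S by (simp add: open_contains_ball)
    from bchoice[OF this] obtain e
      where e: "\<forall>r\<in>?R. 0 < e r \<and> ball (?\<phi> r) (e r) \<subseteq> S"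
      by blast
    let ?T = "\<Union>r\<in>?R. ball (m r) (e r)"
    have "?\<phi> -` S \<inter> space \<mu> = m -` ?T \<inter> space \<mu>"
    proof (intro equalityI subsetI)
      fix r assume "r \<in> ?\<phi> -` S \<inter> space \<mu>"
      then have "r \<in> ?R" by (simp add: space)
      then show "r \<in> m -` ?T \<inter> space \<mu>"
        using e by (force simp: space)
    next
      fix s assume "s \<in> m -` ?T \<inter> space \<mu>"
      then obtain r where r: "r \<in> ?R" "m s \<in> ball (m r) (e r)" and s: "s \<in> {0..1}"
        by (auto simp: space)
      then have "?\<phi> s \<in> ball (?\<phi> r) (e r)"
        using dist[of r s] by simp
      then show "s \<in> ?\<phi> -` S \<inter> space \<mu>"
        using e r(1) s by (auto simp: space subset_iff)
    qed
    moreover have "?T \<in> sets borel"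
      by (intro borel_open open_UN) auto
    ultimately show "?\<phi> -` S \<inter> space \<mu> \<in> sets \<mu>"
      using measurable_sets[OF m] by simp
  qed
qed

end

theory Submission
  imports Defs
begin

text \<open>
  A monotone \<open>f\<close> is represented by its level sets \<open>{f \<ge> 1 - r}\<close> and the uniform measure.
  For uniqueness, write \<open>\<mu>\<close> as the law of its quantile function \<open>q\<close> at a uniform point \<open>u\<close>.
  Since \<open>f x\<close> is the \<open>\<mu>\<close>-measure of the upward closed set of all \<open>r\<close> with \<open>x \<in> A r\<close>,
  one finds \<open>{f > 1 - u} \<subseteq> A (q u) \<subseteq> {f \<ge> 1 - u}\<close>. The level set
  \<open>{f = 1 - u}\<close> has positive Lebesgue measure for at most countably many \<open>u\<close>, so for almost every
  \<open>u\<close> the class of \<open>A (q u)\<close> depends on \<open>f\<close> only.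
\<close>

section \<open>Probability measures on the unit interval and their quantile functions\<close>

lemma space_borel_prob_on_unit: "borel_prob_on_unit \<mu> \<Longrightarrow> space \<mu> = {0..1}"
  using sets_eq_imp_space_eq[of \<mu> "restrict_space borel {0..1}"]
  by (simp add: borel_prob_on_unit_def space_restrict_space)

lemma sets_borel_prob_on_unit_iff:
  "borel_prob_on_unit \<mu> \<Longrightarrow> X \<in> sets \<mu> \<longleftrightarrow> X \<in> sets borel \<and> X \<subseteq> {0..1}"
  by (auto simp: borel_prob_on_unit_def sets_restrict_space_iff)

lemma borel_prob_on_unit_lborel: "borel_prob_on_unit (restrict_space lborel {0..1})"
  by (auto simp: borel_prob_on_unit_def emeasure_restrict_space space_restrict_space
      sets_restrict_space intro!: prob_spaceI)

text \<open>\<open>q\<close> is the generalized inverse of the distribution function of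
  \<open>\<mu>\<close>. The last two bounds place \<open>u\<close> between the left limit and the
  value of that function at \<open>q u\<close>; the gap between them is the atom of
  \<open>\<mu>\<close> at \<open>q u\<close>.\<close>

lemma borel_prob_on_unit_quantile:
  assumes \<mu>: "borel_prob_on_unit \<mu>"
  obtains q where "q \<in> restrict_space lborel {0<..<1} \<rightarrow>\<^sub>M \<mu>"
    and "distr (restrict_space lborel {0<..<1}) \<mu> q = \<mu>"
    and "\<And>u. u \<in> {0<..<1} \<Longrightarrow> measure \<mu> {r\<in>{0..1}. r < q u} \<le> u"
    and "\<And>u. u \<in> {0<..<1} \<Longrightarrow> u \<le> measure \<mu> {r\<in>{0..1}. r \<le> q u}"
proof -
  let ?\<Omega> = "restrict_space lborel {0<..<1::real}"
  \<comment> \<open>\<open>cdf_distribution\<close> concerns measures on all Borel sets of the line,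
    so \<open>\<mu>\<close> is pushed forward to \<open>borel\<close>.\<close>
  define M where "M = distr \<mu> borel (\<lambda>r. r)"
  interpret \<mu>: prob_space \<mu>
    using \<mu> by (simp add: borel_prob_on_unit_def)
  note space = space_borel_prob_on_unit[OF \<mu>]
  have id: "(\<lambda>r. r) \<in> borel_measurable \<mu>"
    using \<mu> by (simp add: borel_prob_on_unit_def measurable_restrict_space1 cong: measurable_cong_sets)
  interpret cdf_distribution M
    unfolding cdf_distribution_def M_def by (rule \<mu>.real_distribution_distr[OF id])
  have M: "measure M X = measure \<mu> (X \<inter> {0..1})" if "X \<in> sets borel" for X
    using that id by (simp add: M_def measure_distr space)
  define q where "q = I"
  \<comment> \<open>This Galois connection between \<open>C\<close> and \<open>q\<close> yields both
    mass bounds.\<close>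
  have pseudo: "u \<le> C s \<longleftrightarrow> q u \<le> s" if "u \<in> {0<..<1}" for u s
    using that pseudoinverse[of u s] by (simp add: q_def)
  have upper: "u \<le> measure M {..q u}" if "u \<in> {0<..<1}" for u
    using pseudo[OF that, of "q u"] by (simp add: cdf_def)
  \<comment> \<open>The mass of the open half-line is the left limit of \<open>C\<close> at
    \<open>q u\<close>, and \<open>C\<close> stays below \<open>u\<close> to the left of
    \<open>q u\<close>.\<close>
  have lower: "measure M {..<q u} \<le> u" if u: "u \<in> {0<..<1}" for u
  proof (rule tendsto_upperbound[OF cdf_at_left])
    have "C s \<le> u" if "s < q u" for s
      using pseudo[OF u, of s] that by simp
    then show "\<forall>\<^sub>F s in at_left (q u). C s \<le> u"
      by (auto simp: eventually_at_filter)
  qed simp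
  \<comment> \<open>A negative \<open>q u\<close> would need positive mass left of 0; a value above
    1 would force total mass at most \<open>u < 1\<close>.\<close>
  have unit: "q u \<in> {0..1}" if u: "u \<in> {0<..<1}" for u
  proof (rule ccontr)
    assume "q u \<notin> {0..1}"
    then consider "q u < 0" | "q u > 1" by force
    then show False
    proof cases
      case 1
      then have "{..q u} \<inter> {0..1} = {}" by auto
      then show False using upper[OF u] u by (simp add: M)
    next
      case 2
      then have "{..<q u} \<inter> {0..1} = space \<mu>" by (auto simp: space)
      then show False using lower[OF u] u by (simp add: M \<mu>.prob_space)
    qed
  qed
  show thesis
  proof
    have "q \<in> ?\<Omega> \<rightarrow>\<^sub>M restrict_space borel {0..1}"
      using measurable_CI[folded q_def] unit
      by (intro measurable_restrict_space2) (auto simp: space_restrict_space cong: measurable_cong_sets)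
    then show q: "q \<in> ?\<Omega> \<rightarrow>\<^sub>M \<mu>"
      using \<mu> by (simp add: borel_prob_on_unit_def cong: measurable_cong_sets)
    have q': "q \<in> borel_measurable ?\<Omega>"
      using measurable_compose[OF q id] .
    show "distr ?\<Omega> \<mu> q = \<mu>"
    proof (rule measure_eqI)
      fix X assume "X \<in> sets (distr ?\<Omega> \<mu> q)"
      \<comment> \<open>A set in \<open>sets \<mu>\<close> is Borel and lies in the unit interval,
        so the law of \<open>q\<close> can be evaluated on it in \<open>borel\<close>, where it is
        \<open>M\<close>.\<close>
      then have X: "X \<in> sets \<mu>" "X \<in> sets borel" "X \<subseteq> {0..1}"
        using sets_borel_prob_on_unit_iff[OF \<mu>] by auto
      then have "emeasure (distr ?\<Omega> \<mu> q) X = emeasure (distr ?\<Omega> borel q) X"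
        using q q' by (simp add: emeasure_distr)
      also have "\<dots> = emeasure M X"
        by (simp add: distr_I_eq_M[folded q_def])
      also have "\<dots> = emeasure \<mu> X"
        using X id by (simp add: M_def emeasure_distr space Int_absorb2)
      finally show "emeasure (distr ?\<Omega> \<mu> q) X = emeasure \<mu> X" .
    qed simp
    fix u :: real assume u: "u \<in> {0<..<1}"
    have "{..<q u} \<inter> {0..1} = {r\<in>{0..1}. r < q u}" "{..q u} \<inter> {0..1} = {r\<in>{0..1}. r \<le> q u}"
      by auto
    then show "measure \<mu> {r\<in>{0..1}. r < q u} \<le> u" "u \<le> measure \<mu> {r\<in>{0..1}. r \<le> q u}"
      using lower[OF u] upper[OF u] by (simp_all add: M)
  qed
qed

section \<open>Sections of a nested family, monotonicity and existence of a representation\<close>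

lemma nested_up_sets_mono:
  assumes "nested_up_sets A" "r \<in> {0..1}" "s \<in> {0..1}" "r \<le> s"
  shows "A r \<subseteq> A s"
  using assms by (cases "r = s") (auto simp: nested_up_sets_def)

lemma sets_nested_up_sets_section:
  assumes "nested_up_sets A" "borel_prob_on_unit \<mu>"
  shows "{r\<in>{0..1}. x \<in> A r} \<in> sets \<mu>"
proof -
  have "(\<lambda>r. indicat_real (A r) x) -` {1} \<inter> space \<mu> \<in> sets \<mu>"
    by (rule measurable_sets[OF borel_measurable_nested_indicator[OF assms]]) simp
  also have "(\<lambda>r. indicat_real (A r) x) -` {1} \<inter> space \<mu> = {r\<in>{0..1}. x \<in> A r}"
    by (auto simp: space_borel_prob_on_unit[OF assms(2)] indicator_eq_1_iff)
  finally show ?thesis .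
qed

lemma integral_nested_indicator:
  assumes "nested_up_sets A" "borel_prob_on_unit \<mu>"
  shows "(\<integral>r. indicat_real (A r) x \<partial>\<mu>) = measure \<mu> {r\<in>{0..1}. x \<in> A r}"
proof -
  note space = space_borel_prob_on_unit[OF assms(2)]
  have "(\<integral>r. indicat_real (A r) x \<partial>\<mu>) = (\<integral>r. indicat_real {r\<in>{0..1}. x \<in> A r} r \<partial>\<mu>)"
    by (intro Bochner_Integration.integral_cong) (auto simp: space indicator_def)
  also have "\<dots> = measure \<mu> {r\<in>{0..1}. x \<in> A r}"
    using sets.sets_into_space[OF sets_nested_up_sets_section[OF assms]] by (simp add: Int_absorb2)
  finally show ?thesis .
qed

text \<open>Every \<open>A r\<close> is an up-set, so the section of parameters at \<open>x\<close>
  lies in the section at \<open>y\<close>; nestedness makes both sections measurable.\<close>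

lemma represents_imp_mono_on:
  assumes A: "nested_up_sets A" and \<mu>: "borel_prob_on_unit \<mu>" and f: "represents A \<mu> f"
  shows "mono_on {0..1} f"
proof (rule mono_onI)
  interpret prob_space \<mu>
    using \<mu> by (simp add: borel_prob_on_unit_def)
  fix x y :: "real^'a" assume xy: "x \<in> {0..1}" "y \<in> {0..1}" "x \<le> y"
  have "measure \<mu> {r\<in>{0..1}. x \<in> A r} \<le> measure \<mu> {r\<in>{0..1}. y \<in> A r}"
    using A xy sets_nested_up_sets_section[OF A \<mu>]
    by (intro finite_measure_mono) (auto simp: nested_up_sets_def up_set_def)
  then show "f x \<le> f y"
    using f xy by (simp add: represents_def integral_nested_indicator[OF A \<mu>])
qed

text \<open>The level \<open>1 - r\<close> rather than \<open>r\<close> makes the sets grow with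
  \<open>r\<close>. The section at \<open>x\<close> is then an interval of length
  \<open>f x\<close>.\<close>

lemma mono_on_imp_represents:
  fixes f :: "real^'n \<Rightarrow> real"
  assumes mono: "mono_on {0..1} f" and range: "f \<in> {0..1} \<rightarrow> {0..1}"
  defines "A \<equiv> \<lambda>r. {x\<in>{0..1}. 1 - r \<le> f x}"
  shows "nested_up_sets A" "represents A (restrict_space lborel {0..1}) f"
proof -
  show A: "nested_up_sets A"
    using mono by (fastforce simp: A_def nested_up_sets_def up_set_def dest: mono_onD)
  show "represents A (restrict_space lborel {0..1}) f"
    unfolding represents_def
  proof
    fix x :: "real^'n" assume x: "x \<in> {0..1}"
    then have "f x \<in> {0..1}"
      using range by auto
    then have "{r\<in>{0..1}. x \<in> A r} = {1 - f x..1}"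
      using x by (auto simp: A_def)
    then show "f x = (\<integral>r. indicat_real (A r) x \<partial>restrict_space lborel {0..1})"
      using \<open>f x \<in> {0..1}\<close>
      by (simp add: integral_nested_indicator[OF A borel_prob_on_unit_lborel]
          measure_restrict_space)
  qed
qed

section \<open>Up-sets at a quantile lie between level sets\<close>

text \<open>The two mass bounds say that \<open>r\<close> is a \<open>u\<close>-quantile of
  \<open>\<mu>\<close>. By nestedness, the section at \<open>x\<close>, whose mass is
  \<open>f x\<close>, contains all parameters from \<open>r\<close> on if
  \<open>x \<in> A r\<close>, and otherwise only parameters above \<open>r\<close>. The former have
  mass at least \<open>1 - u\<close>, the latter at most \<open>1 - u\<close>.\<close>

lemma represents_sandwich:
  assumes A: "nested_up_sets A" and \<mu>: "borel_prob_on_unit \<mu>" and f: "represents A \<mu> f"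
    and r: "r \<in> {0..1}"
    and lower: "measure \<mu> {s\<in>{0..1}. s < r} \<le> u"
    and upper: "u \<le> measure \<mu> {s\<in>{0..1}. s \<le> r}"
  shows "{x\<in>{0..1}. 1 - u < f x} \<subseteq> A r" "A r \<subseteq> {x\<in>{0..1}. 1 - u \<le> f x}"
proof -
  interpret prob_space \<mu>
    using \<mu> by (simp add: borel_prob_on_unit_def)
  note space = space_borel_prob_on_unit[OF \<mu>]
  have sets: "{s\<in>{0..1}. s < r} \<in> sets \<mu>" "{s\<in>{0..1}. s \<le> r} \<in> sets \<mu>"
    by (auto simp: sets_borel_prob_on_unit_iff[OF \<mu>])
  have f_eq: "f x = measure \<mu> {s\<in>{0..1}. x \<in> A s}" if "x \<in> {0..1}" for x
    using f that by (simp add: represents_def integral_nested_indicator[OF A \<mu>])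
  note sec = sets_nested_up_sets_section[OF A \<mu>]
  show "{x\<in>{0..1}. 1 - u < f x} \<subseteq> A r"
  proof (rule subsetI, rule ccontr)
    fix x assume x: "x \<in> {x\<in>{0..1}. 1 - u < f x}" and "x \<notin> A r"
    then have "{s\<in>{0..1}. x \<in> A s} \<subseteq> space \<mu> - {s\<in>{0..1}. s \<le> r}"
      using nested_up_sets_mono[OF A _ r] by (auto simp: space)
    then have "f x \<le> measure \<mu> (space \<mu> - {s\<in>{0..1}. s \<le> r})"
      using x sets by (subst f_eq) (auto intro!: finite_measure_mono)
    also have "\<dots> = 1 - measure \<mu> {s\<in>{0..1}. s \<le> r}"
      using sets by (intro prob_compl)
    finally show False
      using x upper by simp
  qed
  show "A r \<subseteq> {x\<in>{0..1}. 1 - u \<le> f x}"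
  proof
    fix x assume x: "x \<in> A r"
    then have cube: "x \<in> {0..1}"
      using A r unfolding nested_up_sets_def up_set_def by blast
    have "1 - u \<le> 1 - measure \<mu> {s\<in>{0..1}. s < r}"
      using lower by simp
    also have "\<dots> = measure \<mu> (space \<mu> - {s\<in>{0..1}. s < r})"
      using sets by (intro prob_compl[symmetric])
    also have "\<dots> \<le> measure \<mu> {s\<in>{0..1}. x \<in> A s}"
      using x nested_up_sets_mono[OF A r] by (intro finite_measure_mono sec) (force simp: space)
    finally show "x \<in> {x\<in>{0..1}. 1 - u \<le> f x}"
      using cube by (simp add: f_eq)
  qed
qed

section \<open>Measurability and null level sets of a monotone function\<close>

text \<open>Superlevel sets of a monotone function are up-sets, hence Lebesgue measurable.\<close>

lemma borel_measurable_mono_on_cube: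
  fixes f :: "real^'n \<Rightarrow> real"
  assumes "mono_on {0..1} f"
  shows "f \<in> borel_measurable cube_measure"
  unfolding borel_measurable_iff_ge
proof
  fix a
  have "up_set {x\<in>{0..1}. a \<le> f x}"
    using assms by (fastforce simp: up_set_def dest: mono_onD)
  then show "{x \<in> space cube_measure. a \<le> f x} \<in> sets cube_measure"
    using up_set_sets_lebesgue by (auto simp: sets_restrict_space_iff)
qed

text \<open>Such values are the atoms of the law of \<open>f\<close> under the finite cube measure,
  and a finite measure has only countably many atoms.\<close>

lemma countable_non_null_level_sets:
  fixes f :: "real^'n \<Rightarrow> real"
  assumes "f \<in> borel_measurable cube_measure"
  shows "countable {a. \<not> (AE x in cube_measure. f x \<noteq> a)}"
proof -
  interpret finite_measure "cube_measure :: (real^'n) measure"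
    by (rule finite_measure_lebesgue_on)
       (use lmeasurable_cbox[of 0 "1::real^'n"] in \<open>simp add: cbox_interval\<close>)
  interpret D: finite_measure "distr cube_measure borel f"
    using assms by (rule finite_measure_distr)
  have "measure (distr cube_measure borel f) {a} = 0 \<longleftrightarrow> (AE x in cube_measure. f x \<noteq> a)" for a
  proof -
    have "measure (distr cube_measure borel f) {a} = 0
        \<longleftrightarrow> f -` {a} \<inter> space cube_measure \<in> null_sets cube_measure"
      using assms measurable_sets[OF assms, of "{a}"]
      by (simp add: measure_distr emeasure_eq_measure null_sets_def)
    also have "\<dots> \<longleftrightarrow> (AE x in cube_measure. f x \<noteq> a)"
      using assms measurable_sets[OF assms, of "{a}"]
      by (subst AE_iff_null_sets) (auto intro!: AE_cong)
    finally show ?thesis .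
  qed
  then show ?thesis
    using D.countable_support by simp
qed

section \<open>Uniqueness of the law\<close>

text \<open>The quantile functions couple the two laws: both become laws of random classes driven by
  the same uniform \<open>u\<close>, and these classes agree for almost every
  \<open>u\<close>.\<close>

lemma represents_imp_up_set_law_eq:
  fixes f :: "real^'n \<Rightarrow> real"
  assumes A: "nested_up_sets A" and \<mu>: "borel_prob_on_unit \<mu>" and f: "represents A \<mu> f"
    and A': "nested_up_sets A'" and \<mu>': "borel_prob_on_unit \<mu>'" and f': "represents A' \<mu>' f"
  shows "up_set_law A \<mu> = up_set_law A' \<mu>'"
proof -
  let ?\<Omega> = "restrict_space lborel {0<..<1::real}"
  obtain q where q: "q \<in> ?\<Omega> \<rightarrow>\<^sub>M \<mu>" "distr ?\<Omega> \<mu> q = \<mu>"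
    "\<And>u. u \<in> {0<..<1} \<Longrightarrow> measure \<mu> {r\<in>{0..1}. r < q u} \<le> u"
    "\<And>u. u \<in> {0<..<1} \<Longrightarrow> u \<le> measure \<mu> {r\<in>{0..1}. r \<le> q u}"
    using borel_prob_on_unit_quantile[OF \<mu>] by blast
  obtain q' where q': "q' \<in> ?\<Omega> \<rightarrow>\<^sub>M \<mu>'" "distr ?\<Omega> \<mu>' q' = \<mu>'"
    "\<And>u. u \<in> {0<..<1} \<Longrightarrow> measure \<mu>' {r\<in>{0..1}. r < q' u} \<le> u"
    "\<And>u. u \<in> {0<..<1} \<Longrightarrow> u \<le> measure \<mu>' {r\<in>{0..1}. r \<le> q' u}"
    using borel_prob_on_unit_quantile[OF \<mu>'] by blast
  let ?\<phi> = "\<lambda>r. L1_class (indicat_real (A r))"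
  let ?\<phi>' = "\<lambda>r. L1_class (indicat_real (A' r))"
  have \<phi>: "?\<phi> \<in> borel_measurable \<mu>"
    using A \<mu> by (rule borel_measurable_nested_L1_class)
  have \<phi>': "?\<phi>' \<in> borel_measurable \<mu>'"
    using A' \<mu>' by (rule borel_measurable_nested_L1_class)
  \<comment> \<open>Both up-sets are squeezed between the same two level sets of \<open>f\<close>,
    which differ only by the set where \<open>f x = 1 - u\<close>, null by assumption.\<close>
  have class_eq: "?\<phi> (q u) = ?\<phi>' (q' u)"
    if u: "u \<in> {0<..<1}" and null: "AE x in cube_measure. f x \<noteq> 1 - u" for u
  proof -
    have r: "q u \<in> {0..1}" and r': "q' u \<in> {0..1}"
      using measurable_space[OF q(1), of u] measurable_space[OF q'(1), of u] u
      by (auto simp: space_restrict_space space_borel_prob_on_unit[OF \<mu>] space_borel_prob_on_unit[OF \<mu>'])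
    note s = represents_sandwich[OF A \<mu> f r q(3)[OF u] q(4)[OF u]]
    note s' = represents_sandwich[OF A' \<mu>' f' r' q'(3)[OF u] q'(4)[OF u]]
    have "AE x in cube_measure. indicat_real (A (q u)) x = indicat_real (A' (q' u)) x"
      using null
    proof (rule AE_mp, intro AE_I2 impI)
      fix x assume "x \<in> space cube_measure" "f x \<noteq> 1 - u"
      then show "indicat_real (A (q u)) x = indicat_real (A' (q' u)) x"
        using s s' by (fastforce simp: indicator_def)
    qed
    \<comment> \<open>\<open>L1_eq\<close> is a partial equivalence: besides agreement almost
      everywhere it demands integrability, which holds for indicators of up-sets.\<close>
    moreover have "up_set (A (q u))" "up_set (A' (q' u))"
      using A A' r r' by (auto simp: nested_up_sets_def)
    ultimately have "L1_eq (indicat_real (A (q u))) (indicat_real (A' (q' u)))"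
      by (simp add: L1_eq_def integrable_indicator_up_set)
    then show ?thesis
      by (rule Quotient3_rel_abs[OF Quotient3_L1_cube])
  qed
  let ?N = "{a. \<not> (AE x in cube_measure. f x \<noteq> a)}"
  have "countable ?N"
    using represents_imp_mono_on[OF A \<mu> f]
    by (intro countable_non_null_level_sets borel_measurable_mono_on_cube)
  \<comment> \<open>The reflection turns exceptional values of \<open>f\<close> into exceptional
    \<open>u\<close>; a countable set of these is Lebesgue null.\<close>
  then have "AE u in lborel. u \<notin> (\<lambda>a. 1 - a) ` ?N"
    by (intro AE_not_in countable_imp_null_set_lborel countable_image)
  then have "AE u in lborel. AE x in cube_measure. f x \<noteq> 1 - u"
  proof (rule eventually_mono)
    fix u assume "u \<notin> (\<lambda>a. 1 - a) ` ?N"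
    then show "AE x in cube_measure. f x \<noteq> 1 - u"
      using image_eqI[of u "\<lambda>a. 1 - a" "1 - u" ?N] by auto
  qed
  then have "AE u in ?\<Omega>. ?\<phi> (q u) = ?\<phi>' (q' u)"
    by (subst AE_restrict_space_iff, simp) (erule eventually_mono, use class_eq in blast)
  then have "distr ?\<Omega> borel (?\<phi> \<circ> q) = distr ?\<Omega> borel (?\<phi>' \<circ> q')"
    using measurable_comp[OF q(1) \<phi>] measurable_comp[OF q'(1) \<phi>']
    by (intro distr_cong_AE) simp_all
  then have "distr (distr ?\<Omega> \<mu> q) borel ?\<phi> = distr (distr ?\<Omega> \<mu>' q') borel ?\<phi>'"
    by (simp add: distr_distr \<phi> \<phi>' q(1) q'(1))
  then show ?thesis
    by (simp add: up_set_law_def q(2) q'(2))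
qed

theorem proposition1:
  fixes f :: "real^'n \<Rightarrow> real"
  assumes "f \<in> {0..1} \<rightarrow> {0..1}"
  shows "(mono_on {0..1} f \<longleftrightarrow>
      (\<exists>A \<mu>. nested_up_sets A \<and> borel_prob_on_unit \<mu> \<and> represents A \<mu> f)) \<and>
    (\<forall>A A' \<mu> \<mu>'. mono_on {0..1} f \<and>
      nested_up_sets A \<and> borel_prob_on_unit \<mu> \<and> represents A \<mu> f \<and>
      nested_up_sets A' \<and> borel_prob_on_unit \<mu>' \<and> represents A' \<mu>' f \<longrightarrow>
      up_set_law A \<mu> = up_set_law A' \<mu>')"
  using mono_on_imp_represents[OF _ assms] borel_prob_on_unit_lborel
    represents_imp_mono_on[of _ _ f] represents_imp_up_set_law_eq[of _ _ f] by blast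

end
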